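(* Let $g=(G,g_3):\Omega'\to\Omega$ and $f=(F,f_3):\Omega\to\Omega''$ be smooth positively oriented contact diffeomorphisms between domains in $\mathbb{H}_1$. Then on $\Omega'$ $$\begin{aligned} S_{CR}(f\circ g)&=(S_{CR}(f)\circ g)\,(ZG)^2+(\overline{S_{CR}(f)}\circ g)\,(Z\bar G)^2+S_{CR}(g)\\ &\quad+\Big(\lambda_f(\bar ZZ\lambda_f+Z\bar Z\lambda_f)-4(Z\lambda_f)(\bar Z\lambda_f)\Big)\circ g\;\frac{ZG\,Z\bar G}{2\,(\lambda_f\circ g)^2}\\ &\quad+\frac{1}{2\lambda_g}\Big(\lambda_g\,Z^2G-2\,ZG\,Z\lambda_g\Big)\,\big(Z\ln\lambda_f\big)\circ g\\ &\quad+\frac{1}{2\lambda_g}\Big(\lambda_g\,Z^2\bar G-2\,Z\bar G\,Z\lambda_g\Big)\,\big(\bar Z\ln\lambda_f\big)\circ g . \end{aligned}$$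
   Context: The Heisenberg group $\mathbb{H}_1$ is $\mathbb{C}\times\mathbb{R}$ with coordinates $(z,t)$, $z=x+iy$, and product $(z_1,t_1)(z_2,t_2)=(z_1+z_2,\,t_1+t_2+2\,\mathrm{Im}(z_1\bar z_2))$. Put $X=\partial_x+2y\,\partial_t$, $Y=\partial_y-2x\,\partial_t$, $Z=\frac12(X-iY)$, $\bar Z=\frac12(X+iY)$, $\theta=dt-2y\,dx+2x\,dy$. A local diffeomorphism $f=(f_1+if_2,f_3)=(F,f_3)$ is contact if $f^*\theta=\lambda_f\theta$ with $\lambda_f$ nowhere zero; then $\lambda_f=|ZF|^2-|\bar ZF|^2$. It is positively oriented if $\lambda_f>0$. The CR Schwarzian derivative of a positively oriented contact map $f$ is $$S_{CR}(f)=\tfrac12\lambda_f^{-2}\big(\lambda_f\,Z^2\lambda_f-2(Z\lambda_f)^2\big)=-\tfrac12\lambda_f\,Z^2(\lambda_f^{-1}).$$ *)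

theory Defs
  imports "HOL-Analysis.Analysis"
begin

section \<open>Smooth maps and diffeomorphisms\<close>

text \<open>
  The distribution has no notion of a \<open>C\<^sup>k\<close> map between normed spaces. The recursion below is the
  usual one: all iterated directional derivatives exist and are continuous. It is meant for open
  sets, since derivatives are taken in the whole space.
\<close>

primrec Ck_on :: "nat \<Rightarrow> 'a::real_normed_vector set \<Rightarrow> ('a \<Rightarrow> 'b::real_normed_vector) \<Rightarrow> bool" where
  "Ck_on 0 S f \<longleftrightarrow> continuous_on S f"
| "Ck_on (Suc k) S f \<longleftrightarrow>
     (\<forall>x\<in>S. f differentiable (at x)) \<and>
     (\<forall>v. Ck_on k S (\<lambda>x. frechet_derivative f (at x) v))"

definition smooth_on :: "'a::real_normed_vector set \<Rightarrow> ('a \<Rightarrow> 'b::real_normed_vector) \<Rightarrow> bool" where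
  "smooth_on S f \<longleftrightarrow> (\<forall>k. Ck_on k S f)"

definition smooth_diffeo ::
    "('a::real_normed_vector \<Rightarrow> 'b::real_normed_vector) \<Rightarrow> 'a set \<Rightarrow> 'b set \<Rightarrow> bool" where
  "smooth_diffeo f U V \<longleftrightarrow>
     bij_betw f U V \<and> smooth_on U f \<and> smooth_on V (inv_into U f)"

section \<open>The Heisenberg group\<close>

type_synonym heis = "complex \<times> real"

definition heis_mult :: "heis \<Rightarrow> heis \<Rightarrow> heis" where
  "heis_mult p q = (fst p + fst q, snd p + snd q + 2 * Im (fst p * cnj (fst q)))"

text \<open>
  Tangent vectors at a point of \<open>\<complex> \<times> \<real>\<close> are identified with elements of \<open>\<complex> \<times> \<real>\<close>; the
  coordinate fields \<open>\<partial>\<^sub>x, \<partial>\<^sub>y, \<partial>\<^sub>t\<close> are the constants \<open>(1, 0), (\<i>, 0), (0, 1)\<close>.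
\<close>

definition X_field :: "heis \<Rightarrow> heis" where
  "X_field p = (1, 2 * Im (fst p))"

definition Y_field :: "heis \<Rightarrow> heis" where
  "Y_field p = (\<i>, - 2 * Re (fst p))"

lemma X_field_left_invariant:
  "((\<lambda>s. heis_mult p (of_real s, 0)) has_vector_derivative X_field p) (at 0)"
  unfolding heis_mult_def X_field_def has_vector_derivative_def
  by (auto intro!: derivative_eq_intros simp: algebra_simps scaleR_prod_def scaleR_conv_of_real)

lemma Y_field_left_invariant:
  "((\<lambda>s. heis_mult p (of_real s * \<i>, 0)) has_vector_derivative Y_field p) (at 0)"
  unfolding heis_mult_def Y_field_def has_vector_derivative_def
  by (auto intro!: derivative_eq_intros simp: algebra_simps scaleR_prod_def scaleR_conv_of_real)

definition X :: "(heis \<Rightarrow> complex) \<Rightarrow> heis \<Rightarrow> complex" where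
  "X u p = frechet_derivative u (at p) (X_field p)"

definition Y :: "(heis \<Rightarrow> complex) \<Rightarrow> heis \<Rightarrow> complex" where
  "Y u p = frechet_derivative u (at p) (Y_field p)"

definition Z :: "(heis \<Rightarrow> complex) \<Rightarrow> heis \<Rightarrow> complex" where
  "Z u p = (X u p - \<i> * Y u p) / 2"

definition Zbar :: "(heis \<Rightarrow> complex) \<Rightarrow> heis \<Rightarrow> complex" where
  "Zbar u p = (X u p + \<i> * Y u p) / 2"

section \<open>Contact maps\<close>

text \<open>The form \<open>\<theta> = dt - 2y dx + 2x dy\<close>, evaluated at the point \<open>p\<close> on the tangent vector \<open>v\<close>.\<close>

definition theta :: "heis \<Rightarrow> heis \<Rightarrow> real" where
  "theta p v = snd v - 2 * Im (fst p) * Re (fst v) + 2 * Re (fst p) * Im (fst v)"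

definition pullback :: "(heis \<Rightarrow> heis) \<Rightarrow> (heis \<Rightarrow> heis \<Rightarrow> real) \<Rightarrow> heis \<Rightarrow> heis \<Rightarrow> real" where
  "pullback f \<omega> p v = \<omega> (f p) (frechet_derivative f (at p) v)"

definition contact_on :: "(heis \<Rightarrow> heis) \<Rightarrow> heis set \<Rightarrow> bool" where
  "contact_on f U \<longleftrightarrow>
     (\<exists>l. \<forall>p\<in>U. l p \<noteq> 0 \<and> (\<forall>v. pullback f theta p v = l p * theta p v))"

text \<open>
  The function \<open>\<lambda>\<^sub>f\<close> with \<open>f\<^sup>* \<theta> = \<lambda>\<^sub>f \<theta>\<close>. It is unspecified at points where no such
  factor exists; where one exists it is unique because \<open>\<theta>\<close> vanishes nowhere.
\<close>

definition contact_factor :: "(heis \<Rightarrow> heis) \<Rightarrow> heis \<Rightarrow> real" where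
  "contact_factor f p = (THE l. \<forall>v. pullback f theta p v = l * theta p v)"

lemma contact_factor_eqI:
  assumes "\<And>v. pullback f theta p v = l * theta p v"
  shows "contact_factor f p = l"
  unfolding contact_factor_def
proof (rule the_equality)
  fix m assume "\<forall>v. pullback f theta p v = m * theta p v"
  then have "m * theta p (0, 1) = l * theta p (0, 1)"
    using assms by metis
  then show "m = l" by (simp add: theta_def)
qed (use assms in blast)

definition positively_oriented_on :: "(heis \<Rightarrow> heis) \<Rightarrow> heis set \<Rightarrow> bool" where
  "positively_oriented_on f U \<longleftrightarrow> (\<forall>p\<in>U. contact_factor f p > 0)"

abbreviation lam :: "(heis \<Rightarrow> heis) \<Rightarrow> heis \<Rightarrow> complex" where
  "lam f \<equiv> (\<lambda>p. complex_of_real (contact_factor f p))"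

abbreviation ln_lam :: "(heis \<Rightarrow> heis) \<Rightarrow> heis \<Rightarrow> complex" where
  "ln_lam f \<equiv> (\<lambda>p. complex_of_real (ln (contact_factor f p)))"

definition S_CR :: "(heis \<Rightarrow> heis) \<Rightarrow> heis \<Rightarrow> complex" where
  "S_CR f p = (lam f p * Z (Z (lam f)) p - 2 * (Z (lam f) p)\<^sup>2) / (2 * (lam f p)\<^sup>2)"

end

theory Submission
  imports Defs
begin

text \<open>
  A contact map sends horizontal vectors to horizontal vectors, so the chain rule along \<open>Z\<close> has no
  \<open>\<partial>\<^sub>t\<close> term: \<open>Z (u \<circ> g) = (Z u \<circ> g) Z G + (Zbar u \<circ> g) Z Gbar\<close>. Since the contact factors
  multiply, \<open>\<lambda> (f \<circ> g) = (\<lambda> f \<circ> g) \<lambda> g\<close>, the composition formula follows by applying this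
  rule twice to \<open>\<lambda> f \<circ> g\<close>; the smoothness of \<open>\<lambda> f\<close> comes from \<open>\<lambda> f = (f\<^sup>* \<theta>) \<partial>\<^sub>t\<close>.
\<close>

section \<open>Smooth maps\<close>

text \<open>A derivative at a point of an open set depends only on nearby values, and induction over
  arbitrary functions carries this to every order. It allows a derivative to be replaced by a
  formula valid only on \<open>S\<close>.\<close>

lemma Ck_on_cong:
  assumes "open S" "\<And>x. x \<in> S \<Longrightarrow> f x = h x" "Ck_on k S f"
  shows "Ck_on k S h"
  using assms(2,3)
proof (induction k arbitrary: f h)
  case 0
  then show ?case by (metis Ck_on.simps(1) continuous_on_cong)
next
  case (Suc k)
  have df: "f differentiable at x" if "x \<in> S" for x
    using Suc.prems(2) that by simp
  have "h differentiable at x" if "x \<in> S" for x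
    using df[OF that] Suc.prems(1) has_derivative_transform_within_open[OF _ \<open>open S\<close> that]
    unfolding differentiable_def by metis
  moreover have "Ck_on k S (\<lambda>x. frechet_derivative h (at x) v)" for v
  proof (rule Suc.IH)
    show "Ck_on k S (\<lambda>x. frechet_derivative f (at x) v)"
      using Suc.prems(2) by simp
    show "frechet_derivative f (at x) v = frechet_derivative h (at x) v" if "x \<in> S" for x
      using frechet_derivative_transform_within_open[OF df[OF that] \<open>open S\<close> that] Suc.prems(1)
      by metis
  qed
  ultimately show ?case by simp
qed

lemma Ck_on_SucD: "Ck_on (Suc k) S f \<Longrightarrow> Ck_on k S f"
proof (induction k arbitrary: f)
  case 0
  then show ?case
    by (auto intro!: continuous_at_imp_continuous_on differentiable_imp_continuous_within)
qed simp

lemma smooth_on_differentiable: "smooth_on S f \<Longrightarrow> x \<in> S \<Longrightarrow> f differentiable at x"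
  unfolding smooth_on_def by (metis Ck_on.simps(2))

lemma smooth_on_frechet_derivative:
  "smooth_on S f \<Longrightarrow> smooth_on S (\<lambda>x. frechet_derivative f (at x) v)"
  unfolding smooth_on_def by (metis Ck_on.simps(2))

lemma smooth_on_cong:
  "open S \<Longrightarrow> (\<And>x. x \<in> S \<Longrightarrow> f x = h x) \<Longrightarrow> smooth_on S f \<Longrightarrow> smooth_on S h"
  unfolding smooth_on_def by (metis Ck_on_cong)

section \<open>Smoothness under bounded linear maps, sums and bilinear products\<close>

lemma frechet_derivative_bounded_linear_compose:
  assumes "bounded_linear L" "f differentiable at x"
  shows "frechet_derivative (\<lambda>x. L (f x)) (at x) v = L (frechet_derivative f (at x) v)"
  using frechet_derivative_at[OF bounded_linear.has_derivative[OF assms(1)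
        frechet_derivative_works[THEN iffD1, OF assms(2)]]]
  by metis

lemma Ck_on_bounded_linear:
  assumes "bounded_linear L" "open S" "Ck_on k S f"
  shows "Ck_on k S (\<lambda>x. L (f x))"
  using assms(3)
proof (induction k arbitrary: f)
  case 0
  then show ?case
    by (simp add: bounded_linear.continuous_on[OF assms(1)])
next
  case (Suc k)
  have "Ck_on k S (\<lambda>x. frechet_derivative (\<lambda>x. L (f x)) (at x) v)" for v
  proof (rule Ck_on_cong[OF \<open>open S\<close>])
    show "Ck_on k S (\<lambda>x. L (frechet_derivative f (at x) v))"
      using Suc by simp
    show "L (frechet_derivative f (at x) v) = frechet_derivative (\<lambda>x. L (f x)) (at x) v"
      if "x \<in> S" for x
      using Suc.prems that
      by (simp add: frechet_derivative_bounded_linear_compose[OF assms(1)])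
  qed
  moreover have "(\<lambda>x. L (f x)) differentiable at x" if "x \<in> S" for x
    using differentiable_compose[OF bounded_linear_imp_differentiable[OF assms(1)]]
      Suc.prems that by fastforce
  ultimately show ?case by simp
qed

lemma frechet_derivative_plus:
  assumes "f differentiable at x" "h differentiable at x"
  shows "frechet_derivative (\<lambda>x. f x + h x) (at x) v
    = frechet_derivative f (at x) v + frechet_derivative h (at x) v"
  using frechet_derivative_at[OF has_derivative_add[OF
        assms[THEN frechet_derivative_works[THEN iffD1]]]]
  by metis

lemma Ck_on_add:
  assumes "open S" "Ck_on k S f" "Ck_on k S h"
  shows "Ck_on k S (\<lambda>x. f x + h x)"
  using assms(2,3)
proof (induction k arbitrary: f h)
  case 0
  then show ?case by (simp add: continuous_on_add)
next
  case (Suc k)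
  have "Ck_on k S (\<lambda>x. frechet_derivative (\<lambda>x. f x + h x) (at x) v)" for v
  proof (rule Ck_on_cong[OF \<open>open S\<close>])
    show "Ck_on k S (\<lambda>x. frechet_derivative f (at x) v + frechet_derivative h (at x) v)"
      using Suc by simp
    show "frechet_derivative f (at x) v + frechet_derivative h (at x) v
      = frechet_derivative (\<lambda>x. f x + h x) (at x) v" if "x \<in> S" for x
      using Suc.prems that by (simp add: frechet_derivative_plus)
  qed
  then show ?case using Suc.prems by simp
qed

lemma frechet_derivative_bilinear:
  assumes "bounded_bilinear B" "f differentiable at x" "h differentiable at x"
  shows "frechet_derivative (\<lambda>x. B (f x) (h x)) (at x) v
    = B (f x) (frechet_derivative h (at x) v) + B (frechet_derivative f (at x) v) (h x)"
  using frechet_derivative_at[OF bounded_bilinear.FDERIV[OF assms(1)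
        frechet_derivative_works[THEN iffD1, OF assms(2)] frechet_derivative_works[THEN iffD1, OF assms(3)]]]
  by metis

text \<open>By the Leibniz rule each directional derivative is a sum of two expressions of the same
  bilinear shape, so the induction has to range over all \<open>f\<close> and \<open>h\<close>.
  Stating it for a general \<open>B\<close> covers both \<open>scaleR\<close> and
  multiplication.\<close>

lemma Ck_on_bilinear:
  assumes "bounded_bilinear B" "open S" "Ck_on k S f" "Ck_on k S h"
  shows "Ck_on k S (\<lambda>x. B (f x) (h x))"
  using assms(3,4)
proof (induction k arbitrary: f h)
  case 0
  then show ?case by (simp add: bounded_bilinear.continuous_on[OF assms(1)])
next
  case (Suc k)
  have d: "f differentiable at x" "h differentiable at x" if "x \<in> S" for x
    using Suc.prems that by simp_all
  have "Ck_on k S (\<lambda>x. frechet_derivative (\<lambda>x. B (f x) (h x)) (at x) v)" for v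
  proof (rule Ck_on_cong[OF \<open>open S\<close>])
    show "Ck_on k S (\<lambda>x. B (f x) (frechet_derivative h (at x) v)
      + B (frechet_derivative f (at x) v) (h x))"
      \<comment> \<open>Each summand has one factor that is not differentiated;
        \<open>Ck_on_SucD\<close> lowers its order to \<open>k\<close>. For this the hypotheses must
        first stay folded at order \<open>Suc k\<close>.\<close>
      using Suc.prems
      by (intro Ck_on_add[OF \<open>open S\<close>] Suc.IH) (auto dest: Ck_on_SucD simp del: Ck_on.simps, auto)
    show "B (f x) (frechet_derivative h (at x) v) + B (frechet_derivative f (at x) v) (h x)
      = frechet_derivative (\<lambda>x. B (f x) (h x)) (at x) v" if "x \<in> S" for x
      using frechet_derivative_bilinear[OF assms(1) d[OF that]] by simp
  qed
  moreover have "(\<lambda>x. B (f x) (h x)) differentiable at x" if "x \<in> S" for x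
    using d[OF that] bounded_bilinear.FDERIV[OF assms(1)] unfolding differentiable_def by blast
  ultimately show ?case by simp
qed

lemma Ck_on_const: "Ck_on k S (\<lambda>x. c)"
  by (induction k arbitrary: c) simp_all

lemma smooth_on_ident: "smooth_on S (\<lambda>x. x)"
  unfolding smooth_on_def
proof
  show "Ck_on k S (\<lambda>x. x)" for k
    \<comment> \<open>A case split is enough: the derivative of the identity in direction
      \<open>v\<close> is the constant \<open>v\<close>.\<close>
    by (cases k) (simp_all add: Ck_on_const)
qed

lemma smooth_on_bounded_linear:
  "bounded_linear L \<Longrightarrow> open S \<Longrightarrow> smooth_on S f \<Longrightarrow> smooth_on S (\<lambda>x. L (f x))"
  unfolding smooth_on_def by (blast intro: Ck_on_bounded_linear)

lemma smooth_on_add: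
  "open S \<Longrightarrow> smooth_on S f \<Longrightarrow> smooth_on S h \<Longrightarrow> smooth_on S (\<lambda>x. f x + h x)"
  unfolding smooth_on_def by (blast intro: Ck_on_add)

lemma smooth_on_bilinear:
  "bounded_bilinear B \<Longrightarrow> open S \<Longrightarrow> smooth_on S f \<Longrightarrow> smooth_on S h
    \<Longrightarrow> smooth_on S (\<lambda>x. B (f x) (h x))"
  unfolding smooth_on_def by (blast intro: Ck_on_bilinear)

section \<open>Calculus of the horizontal fields\<close>

text \<open>\<open>X_field\<close> and \<open>Y_field\<close> vary with the point only in their last
  component. Splitting that component off leaves derivatives in fixed directions, to which
  \<open>smooth_on_frechet_derivative\<close> applies, with a coefficient linear in the
  point.\<close>

lemma frechet_derivative_Pair_split:
  assumes "u differentiable at p"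
  shows "frechet_derivative u (at p) (a, b)
    = frechet_derivative u (at p) (a, 0) + b *\<^sub>R frechet_derivative u (at p) (0, 1)"
proof -
  interpret bounded_linear "frechet_derivative u (at p)"
    using assms frechet_derivative_works has_derivative_bounded_linear by blast
  have "(a, b) = (a, 0) + b *\<^sub>R (0, 1::real)" by simp
  then show ?thesis by (metis add scaleR)
qed

section \<open>Smoothness of derivatives along the horizontal fields\<close>

lemma smooth_on_X:
  assumes "open S" "smooth_on S u"
  shows "smooth_on S (X u)"
proof (rule smooth_on_cong[OF \<open>open S\<close>])
  show "smooth_on S (\<lambda>p. frechet_derivative u (at p) (1, 0)
    + (2 * Im (fst p)) *\<^sub>R frechet_derivative u (at p) (0, 1))"
    by (intro smooth_on_add smooth_on_bilinear[OF bounded_bilinear_scaleR]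
        smooth_on_frechet_derivative assms smooth_on_ident
        smooth_on_bounded_linear[where L = "\<lambda>p. 2 * Im (fst p)"] bounded_linear_const_mult
        bounded_linear_compose[OF bounded_linear_Im] bounded_linear_fst bounded_linear_ident)
  show "frechet_derivative u (at p) (1, 0)
    + (2 * Im (fst p)) *\<^sub>R frechet_derivative u (at p) (0, 1) = X u p" if "p \<in> S" for p
    using frechet_derivative_Pair_split[OF smooth_on_differentiable[OF assms(2) that]]
    unfolding X_def X_field_def by metis
qed

lemma smooth_on_Y:
  assumes "open S" "smooth_on S u"
  shows "smooth_on S (Y u)"
proof (rule smooth_on_cong[OF \<open>open S\<close>])
  show "smooth_on S (\<lambda>p. frechet_derivative u (at p) (\<i>, 0)
    + (- 2 * Re (fst p)) *\<^sub>R frechet_derivative u (at p) (0, 1))"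
    by (intro smooth_on_add smooth_on_bilinear[OF bounded_bilinear_scaleR]
        smooth_on_frechet_derivative assms smooth_on_ident
        smooth_on_bounded_linear[where L = "\<lambda>p. - 2 * Re (fst p)"] bounded_linear_const_mult
        bounded_linear_compose[OF bounded_linear_Re] bounded_linear_fst bounded_linear_ident)
  show "frechet_derivative u (at p) (\<i>, 0)
    + (- 2 * Re (fst p)) *\<^sub>R frechet_derivative u (at p) (0, 1) = Y u p" if "p \<in> S" for p
    using frechet_derivative_Pair_split[OF smooth_on_differentiable[OF assms(2) that]]
    unfolding Y_def Y_field_def by metis
qed

lemma smooth_on_Z:
  assumes "open S" "smooth_on S u"
  shows "smooth_on S (Z u)"
proof (rule smooth_on_cong[OF \<open>open S\<close>])
  show "smooth_on S (\<lambda>p. (1/2) * X u p + (- \<i>/2) * Y u p)"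
    by (intro smooth_on_add smooth_on_bounded_linear[OF bounded_linear_mult_right]
        smooth_on_X smooth_on_Y assms)
qed (simp add: Z_def field_simps)

lemma smooth_on_Zbar:
  assumes "open S" "smooth_on S u"
  shows "smooth_on S (Zbar u)"
proof (rule smooth_on_cong[OF \<open>open S\<close>])
  show "smooth_on S (\<lambda>p. (1/2) * X u p + (\<i>/2) * Y u p)"
    by (intro smooth_on_add smooth_on_bounded_linear[OF bounded_linear_mult_right]
        smooth_on_X smooth_on_Y assms)
qed (simp add: Zbar_def field_simps)

section \<open>Locality and differentiation rules for \<open>Z\<close> and
  \<open>Zbar\<close>\<close>

lemma Z_cong:
  assumes "open S" "p \<in> S" "\<And>x. x \<in> S \<Longrightarrow> u x = v x" "u differentiable at p"
  shows "Z u p = Z v p"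
  using frechet_derivative_transform_within_open[OF assms(4,1,2), of v] assms(3)
  unfolding Z_def X_def Y_def by metis

lemma Zbar_cong:
  assumes "open S" "p \<in> S" "\<And>x. x \<in> S \<Longrightarrow> u x = v x" "u differentiable at p"
  shows "Zbar u p = Zbar v p"
  using frechet_derivative_transform_within_open[OF assms(4,1,2), of v] assms(3)
  unfolding Zbar_def X_def Y_def by metis

lemma Z_add:
  assumes "u differentiable at p" "v differentiable at p"
  shows "Z (\<lambda>x. u x + v x) p = Z u p + Z v p"
  using assms unfolding Z_def X_def Y_def
  by (simp add: frechet_derivative_plus field_simps)

lemma Z_mult:
  assumes "u differentiable at p" "v differentiable at p"
  shows "Z (\<lambda>x. u x * v x) p = Z u p * v p + u p * Z v p"
  unfolding Z_def X_def Y_def frechet_derivative_bilinear[OF bounded_bilinear_mult assms]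
  by (simp add: field_simps)

text \<open>The fields \<open>X\<close> and \<open>Y\<close> are real, so they commute with
  conjugation, which then only flips the sign of \<open>\<i>\<close> in \<open>Z\<close>.\<close>

lemma Zbar_cnj:
  assumes "u differentiable at p"
  shows "Zbar (\<lambda>x. cnj (u x)) p = cnj (Z u p)"
  unfolding Zbar_def Z_def X_def Y_def
    frechet_derivative_bounded_linear_compose[OF bounded_linear_cnj assms]
  by simp

lemma frechet_derivative_of_real_ln:
  fixes r :: "'a::real_normed_vector \<Rightarrow> real"
  assumes "(\<lambda>x. complex_of_real (r x)) differentiable at p" "r p > 0"
  shows "frechet_derivative (\<lambda>x. complex_of_real (ln (r x))) (at p) v
    = frechet_derivative (\<lambda>x. complex_of_real (r x)) (at p) v / of_real (r p)"
proof -
  \<comment> \<open>Differentiability is assumed for the complex-valued function; its real part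
    gives it back for \<open>r\<close>.\<close>
  have "(\<lambda>x. Re (complex_of_real (r x))) differentiable at p"
    using differentiable_compose[OF bounded_linear_imp_differentiable[OF bounded_linear_Re] assms(1)] .
  then have dr: "(r has_derivative frechet_derivative r (at p)) (at p)"
    by (simp add: frechet_derivative_works[symmetric])
  have "((\<lambda>x. complex_of_real (ln (r x))) has_derivative
      (\<lambda>v. of_real (frechet_derivative r (at p) v * inverse (r p)))) (at p)"
    using assms(2)
    by (auto intro!: derivative_eq_intros dr simp: divide_inverse)
  moreover have "((\<lambda>x. complex_of_real (r x)) has_derivative
      (\<lambda>v. of_real (frechet_derivative r (at p) v))) (at p)"
    by (intro has_derivative_of_real dr)
  ultimately show ?thesis
    using frechet_derivative_at by (metis divide_inverse of_real_divide)
qed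

lemma ln_lam_derivatives:
  assumes "lam f differentiable at p" "contact_factor f p > 0"
  shows "Z (ln_lam f) p = Z (lam f) p / lam f p"
    and "Zbar (ln_lam f) p = Zbar (lam f) p / lam f p"
  unfolding Z_def Zbar_def X_def Y_def frechet_derivative_of_real_ln[OF assms]
  by (simp_all add: add_divide_distrib diff_divide_distrib mult.commute)

section \<open>Contact maps\<close>

text \<open>Links the existentially quantified factor in \<open>contact_on\<close> with the definite
  description \<open>contact_factor\<close>, by uniqueness of the factor.\<close>

lemma contact_on_pullback:
  assumes "contact_on f U" "p \<in> U"
  shows "pullback f theta p v = contact_factor f p * theta p v"
  using assms contact_factor_eqI unfolding contact_on_def by metis

text \<open>Since \<open>theta\<close> takes the value 1 on the vertical vector
  \<open>(0, 1)\<close>, the factor equals \<open>theta (f p) (W p)\<close> with \<open>W\<close>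
  the image of that vector under the differential of \<open>f\<close>. This is polynomial in the
  components of \<open>f\<close> and \<open>W\<close>.\<close>

lemma smooth_on_lam:
  assumes "open U" "smooth_on U f" "contact_on f U"
  shows "smooth_on U (lam f)"
proof -
  define W where "W = (\<lambda>p. frechet_derivative f (at p) (0, 1))"
  have W: "smooth_on U W"
    unfolding W_def by (intro smooth_on_frechet_derivative assms)
  have lin: "bounded_linear (\<lambda>q::heis. snd q)" "bounded_linear (\<lambda>q::heis. - 2 * Im (fst q))"
      "bounded_linear (\<lambda>q::heis. 2 * Re (fst q))" "bounded_linear (\<lambda>q::heis. Re (fst q))"
      "bounded_linear (\<lambda>q::heis. Im (fst q))"
    by (intro bounded_linear_snd bounded_linear_const_mult bounded_linear_fst
        bounded_linear_compose[OF bounded_linear_Re] bounded_linear_compose[OF bounded_linear_Im])+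
  have "smooth_on U (\<lambda>p. snd (W p) + (- 2 * Im (fst (f p))) * Re (fst (W p))
      + (2 * Re (fst (f p))) * Im (fst (W p)))"
    using \<open>open U\<close> lin[THEN smooth_on_bounded_linear[OF _ \<open>open U\<close> W]]
      lin[THEN smooth_on_bounded_linear[OF _ \<open>open U\<close> assms(2)]]
    by (fast intro: smooth_on_add smooth_on_bilinear[OF bounded_bilinear_mult])
  moreover have "snd (W p) + (- 2 * Im (fst (f p))) * Re (fst (W p))
      + (2 * Re (fst (f p))) * Im (fst (W p)) = contact_factor f p" if "p \<in> U" for p
    using contact_on_pullback[OF assms(3) that, of "(0, 1)"]
    by (simp add: pullback_def theta_def W_def)
  ultimately have "smooth_on U (contact_factor f)"
    using smooth_on_cong[OF \<open>open U\<close>] by (metis (no_types, lifting))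
  then show ?thesis
    by (rule smooth_on_bounded_linear[OF bounded_linear_of_real \<open>open U\<close>])
qed

lemma contact_factor_compose:
  assumes "contact_on g U" "p \<in> U" "g differentiable at p"
    and "contact_on f V" "g p \<in> V" "f differentiable at (g p)"
  shows "contact_factor (f \<circ> g) p = contact_factor f (g p) * contact_factor g p"
proof (rule contact_factor_eqI)
  fix v
  have "pullback (f \<circ> g) theta p v = pullback f theta (g p) (frechet_derivative g (at p) v)"
    by (simp add: pullback_def frechet_derivative_compose[OF assms(3,6)])
  also have "\<dots> = contact_factor f (g p) * pullback g theta p v"
    by (simp add: contact_on_pullback[OF assms(4,5)]) (simp add: pullback_def)
  also have "\<dots> = contact_factor f (g p) * contact_factor g p * theta p v"
    by (simp add: contact_on_pullback[OF assms(1,2)])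
  finally show "pullback (f \<circ> g) theta p v
    = contact_factor f (g p) * contact_factor g p * theta p v" .
qed

section \<open>Chain rule along horizontal vectors\<close>

lemma frechet_derivative_theta_zero:
  assumes "u differentiable at q" "theta q v = 0"
  shows "frechet_derivative u (at q) v = fst v * Z u q + cnj (fst v) * Zbar u q"
proof -
  interpret bounded_linear "frechet_derivative u (at q)"
    using assms frechet_derivative_works has_derivative_bounded_linear by blast
  \<comment> \<open>The first components agree for every \<open>v\<close>; the vanishing of
    \<open>theta q v\<close> determines \<open>snd v\<close> and makes the last components
    agree.\<close>
  have "v = Re (fst v) *\<^sub>R X_field q + Im (fst v) *\<^sub>R Y_field q"
    using assms(2)
    by (cases v) (auto simp: theta_def X_field_def Y_field_def complex_eq_iff algebra_simps)
  then have "frechet_derivative u (at q) v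
      = of_real (Re (fst v)) * X u q + of_real (Im (fst v)) * Y u q"
    unfolding X_def Y_def by (metis add scaleR scaleR_conv_of_real)
  \<comment> \<open>Change of basis \<open>X = Z + Zbar\<close>,
    \<open>Y = \<i> * (Z - Zbar)\<close>.\<close>
  also have "\<dots> = (of_real (Re (fst v)) + \<i> * of_real (Im (fst v))) * Z u q
      + (of_real (Re (fst v)) - \<i> * of_real (Im (fst v))) * Zbar u q"
    by (simp add: Z_def Zbar_def algebra_simps add_divide_distrib diff_divide_distrib)
  also have "of_real (Re (fst v)) + \<i> * of_real (Im (fst v)) = fst v"
    by (simp add: complex_eq_iff)
  also have "of_real (Re (fst v)) - \<i> * of_real (Im (fst v)) = cnj (fst v)"
    by (simp add: complex_eq_iff)
  finally show ?thesis .
qed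

text \<open>The differential of \<open>g\<close> preserves the kernel of \<open>theta\<close>, so
  the expansion in \<open>Z u\<close> and \<open>Zbar u\<close> applies to the images of
  \<open>X_field p\<close> and \<open>Y_field p\<close>. These are real vectors; \<open>Z\<close>
  arises only afterwards, as their complex combination.\<close>

lemma Z_contact_compose:
  assumes "contact_on g U" "p \<in> U" "g differentiable at p" "u differentiable at (g p)"
  shows "Z (\<lambda>q. u (g q)) p = Z u (g p) * Z (\<lambda>q. fst (g q)) p
    + Zbar u (g p) * Z (\<lambda>q. cnj (fst (g q))) p"
proof -
  have chain: "frechet_derivative (\<lambda>q. u (g q)) (at p) v
    = frechet_derivative (\<lambda>q. fst (g q)) (at p) v * Z u (g p)
      + frechet_derivative (\<lambda>q. cnj (fst (g q))) (at p) v * Zbar u (g p)"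
    if "theta p v = 0" for v
  proof -
    have "theta (g p) (frechet_derivative g (at p) v) = 0"
      using contact_on_pullback[OF assms(1,2), of v] that by (simp add: pullback_def)
    moreover have "frechet_derivative (\<lambda>q. u (g q)) (at p) v
        = frechet_derivative u (at (g p)) (frechet_derivative g (at p) v)"
      using frechet_derivative_compose[OF assms(3,4)] by (simp add: comp_def)
    ultimately show ?thesis
      using frechet_derivative_theta_zero[OF assms(4)]
        frechet_derivative_bounded_linear_compose[OF bounded_linear_fst assms(3)]
        frechet_derivative_bounded_linear_compose[OF
          bounded_linear_compose[OF bounded_linear_cnj bounded_linear_fst] assms(3)]
      by simp
  qed
  have "theta p (X_field p) = 0" "theta p (Y_field p) = 0"
    by (simp_all add: theta_def X_field_def Y_field_def)
  note this[THEN chain]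
  then show ?thesis
    unfolding Z_def[of "\<lambda>q. u (g q)"] Z_def[of "\<lambda>q. fst (g q)"]
      Z_def[of "\<lambda>q. cnj (fst (g q))"] X_def Y_def
    by (simp add: algebra_simps add_divide_distrib diff_divide_distrib)
qed

text \<open>The purely algebraic content of the formula. \<open>L\<close> and \<open>M\<close> stand
  for \<open>lam f (g p)\<close> and \<open>lam g p\<close>, \<open>m\<close> and \<open>m'\<close>
  for the first and second \<open>Z\<close> derivatives of \<open>lam g\<close>, \<open>a\<close>
  and \<open>b\<close> for \<open>Z G p\<close> and \<open>Z Gbar p\<close>, and \<open>a'\<close>
  and \<open>b'\<close> for their next \<open>Z\<close> derivatives. Indices 1 and 2 of
  \<open>l\<close> mean \<open>Z\<close> and \<open>Zbar\<close> of \<open>lam f\<close>, the outer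
  operator first; \<open>l12\<close> and \<open>l21\<close> are kept apart because the two operators
  do not commute in general.\<close>

lemma composition_identity:
  fixes L M l1 l2 l11 l12 l21 l22 a b a' b' m m' :: complex
  assumes "L \<noteq> 0" "M \<noteq> 0"
  defines "ZL \<equiv> l1 * a + l2 * b"
  defines "ZZL \<equiv> (l11 * a + l21 * b) * a + l1 * a' + ((l12 * a + l22 * b) * b + l2 * b')"
  shows "(L * M * (ZZL * M + ZL * m + (ZL * m + L * m')) - 2 * (ZL * M + L * m)\<^sup>2)
      / (2 * (L * M)\<^sup>2)
    = (L * l11 - 2 * l1\<^sup>2) / (2 * L\<^sup>2) * a\<^sup>2 + (L * l22 - 2 * l2\<^sup>2) / (2 * L\<^sup>2) * b\<^sup>2
      + (M * m' - 2 * m\<^sup>2) / (2 * M\<^sup>2)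
      + (L * (l21 + l12) - 4 * l1 * l2) * (a * b / (2 * L\<^sup>2))
      + 1 / (2 * M) * (M * a' - 2 * a * m) * (l1 / L)
      + 1 / (2 * M) * (M * b' - 2 * b * m) * (l2 / L)"
  using assms(1,2) unfolding ZL_def ZZL_def by (simp add: field_simps power2_eq_square)

section \<open>Derivation of the composition formula\<close>

theorem mainTheorem4:
  fixes f g :: "heis \<Rightarrow> heis" and \<Omega> \<Omega>' \<Omega>'' :: "heis set" and G Gbar :: "heis \<Rightarrow> complex"
  assumes "open \<Omega>'" "connected \<Omega>'" "\<Omega>' \<noteq> {}"
    and "open \<Omega>" "connected \<Omega>" "\<Omega> \<noteq> {}"
    and "open \<Omega>''" "connected \<Omega>''" "\<Omega>'' \<noteq> {}"
    and "smooth_diffeo g \<Omega>' \<Omega>" "contact_on g \<Omega>'" "positively_oriented_on g \<Omega>'"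
    and "smooth_diffeo f \<Omega> \<Omega>''" "contact_on f \<Omega>" "positively_oriented_on f \<Omega>"
    and "G = (\<lambda>q. fst (g q))" "Gbar = (\<lambda>q. cnj (fst (g q)))"
  shows "\<forall>p\<in>\<Omega>'. S_CR (f \<circ> g) p =
      S_CR f (g p) * (Z G p)\<^sup>2 + cnj (S_CR f (g p)) * (Z Gbar p)\<^sup>2 + S_CR g p
    + (lam f (g p) * (Zbar (Z (lam f)) (g p) + Z (Zbar (lam f)) (g p))
         - 4 * Z (lam f) (g p) * Zbar (lam f) (g p))
      * (Z G p * Z Gbar p / (2 * (lam f (g p))\<^sup>2))
    + 1 / (2 * lam g p) * (lam g p * Z (Z G) p - 2 * Z G p * Z (lam g) p) * Z (ln_lam f) (g p)
    + 1 / (2 * lam g p) * (lam g p * Z (Z Gbar) p - 2 * Z Gbar p * Z (lam g) p)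
      * Zbar (ln_lam f) (g p)"
proof
  fix p assume p: "p \<in> \<Omega>'"
  note op' = \<open>open \<Omega>'\<close> and op = \<open>open \<Omega>\<close>
  have sg: "smooth_on \<Omega>' g" and sf: "smooth_on \<Omega> f" and gin: "\<And>q. q \<in> \<Omega>' \<Longrightarrow> g q \<in> \<Omega>"
    using assms(10,13) by (auto simp: smooth_diffeo_def bij_betw_def)
  note cg = \<open>contact_on g \<Omega>'\<close> and cf = \<open>contact_on f \<Omega>\<close>
  have dg: "g differentiable at q" if "q \<in> \<Omega>'" for q
    using smooth_on_differentiable[OF sg that] .
  have smG: "smooth_on \<Omega>' G" and smK: "smooth_on \<Omega>' Gbar"
    unfolding assms(16,17)
    using smooth_on_bounded_linear[OF bounded_linear_fst op' sg]
      smooth_on_bounded_linear[OF bounded_linear_cnj op'] by blast+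
  note dZG = smooth_on_differentiable[OF smooth_on_Z[OF op' smG]]
    and dZK = smooth_on_differentiable[OF smooth_on_Z[OF op' smK]]
  have slf: "smooth_on \<Omega> (lam f)" and slg: "smooth_on \<Omega>' (lam g)"
    using smooth_on_lam op sf cf op' sg cg by blast+
  note sZ = smooth_on_Z[OF op slf] and sZb = smooth_on_Zbar[OF op slf]
  note dlf = smooth_on_differentiable[OF slf] and dlg = smooth_on_differentiable[OF slg]
    and dZlg = smooth_on_differentiable[OF smooth_on_Z[OF op' slg]]
  have chain: "Z (\<lambda>q. u (g q)) q = Z u (g q) * Z G q + Zbar u (g q) * Z Gbar q"
    if "q \<in> \<Omega>'" "smooth_on \<Omega> u" for u q
    using Z_contact_compose[OF cg that(1) dg[OF that(1)]
        smooth_on_differentiable[OF that(2) gin[OF that(1)]]] assms(16,17) by simp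
  have dcomp: "(\<lambda>q. u (g q)) differentiable at q" if "q \<in> \<Omega>'" "smooth_on \<Omega> u"
    for u :: "heis \<Rightarrow> complex" and q
    using differentiable_compose[OF smooth_on_differentiable[OF that(2) gin[OF that(1)]]
        dg[OF that(1)]] .

  define L where "L = (\<lambda>q. lam f (g q))"
  \<comment> \<open>The chain rule result is named as a function on its own, so that the chain and
    product rules can be applied to it a second time.\<close>
  define ZL where "ZL = (\<lambda>q. Z (lam f) (g q) * Z G q + Zbar (lam f) (g q) * Z Gbar q)"
  have dL: "L differentiable at q" and ZL: "Z L q = ZL q" if "q \<in> \<Omega>'" for q
    using dcomp[OF that slf] chain[OF that slf] unfolding L_def ZL_def by auto
  have dZL: "ZL differentiable at q" if "q \<in> \<Omega>'" for q
    unfolding ZL_def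
    by (intro differentiable_add differentiable_mult dcomp sZ sZb dZG dZK that)
  have ZZL: "Z ZL p = (Z (Z (lam f)) (g p) * Z G p + Zbar (Z (lam f)) (g p) * Z Gbar p) * Z G p
      + Z (lam f) (g p) * Z (Z G) p
      + ((Z (Zbar (lam f)) (g p) * Z G p + Zbar (Zbar (lam f)) (g p) * Z Gbar p) * Z Gbar p
      + Zbar (lam f) (g p) * Z (Z Gbar) p)"
    unfolding ZL_def
    by (simp add: Z_add Z_mult chain differentiable_mult dcomp sZ sZb dZG dZK p)

  have lam_comp: "lam (f \<circ> g) q = L q * lam g q" if "q \<in> \<Omega>'" for q
    using contact_factor_compose[OF cg that dg[OF that] cf gin[OF that]
        smooth_on_differentiable[OF sf gin[OF that]]]
    by (simp add: L_def)
  \<comment> \<open>This is needed on all of \<open>\<Omega>'\<close> and not just at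
    \<open>p\<close>, because it is differentiated again. The factorisation of the contact factor is
    known only on \<open>\<Omega>'\<close>, hence the use of \<open>Z_cong\<close>.\<close>
  have Zlam_comp: "Z (lam (f \<circ> g)) q = ZL q * lam g q + L q * Z (lam g) q" if "q \<in> \<Omega>'" for q
  proof -
    have "Z (lam (f \<circ> g)) q = Z (\<lambda>q. L q * lam g q) q"
      by (rule Z_cong[OF op' that, symmetric])
         (use lam_comp dL dlg that in \<open>auto intro: differentiable_mult\<close>)
    then show ?thesis using Z_mult[OF dL dlg, OF that that] ZL[OF that] by simp
  qed
  \<comment> \<open>The two equal cross terms are left uncollected to match
    \<open>composition_identity\<close> literally.\<close>
  have ZZlam_comp: "Z (Z (lam (f \<circ> g))) p
      = Z ZL p * lam g p + ZL p * Z (lam g) p + (ZL p * Z (lam g) p + L p * Z (Z (lam g)) p)"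
  proof -
    have "Z (Z (lam (f \<circ> g))) p = Z (\<lambda>q. ZL q * lam g q + L q * Z (lam g) q) p"
      by (rule Z_cong[OF op' p, symmetric])
         (use Zlam_comp dL dlg dZL dZlg p in
           \<open>auto intro!: differentiable_mult differentiable_add\<close>)
    then show ?thesis
      by (simp add: Z_add Z_mult differentiable_mult dL dlg dZL dZlg p ZL)
  qed

  \<comment> \<open>\<open>lam f\<close> is real-valued, so conjugation only turns \<open>Z\<close>
    into \<open>Zbar\<close>. Applied twice this expresses the conjugate of \<open>S_CR f\<close>
    through \<open>Zbar\<close>.\<close>
  have cnjZ: "cnj (Z (lam f) q) = Zbar (lam f) q" if "q \<in> \<Omega>" for q
    using Zbar_cnj[OF dlf[OF that]] by simp
  have cnjZZ: "cnj (Z (Z (lam f)) (g p)) = Zbar (Zbar (lam f)) (g p)"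
  proof -
    have d: "Zbar (lam f) differentiable at (g p)"
      using smooth_on_differentiable[OF sZb gin[OF p]] .
    have "cnj (Z (Z (lam f)) (g p)) = Zbar (\<lambda>q. cnj (Z (lam f) q)) (g p)"
      using Zbar_cnj[OF smooth_on_differentiable[OF sZ gin[OF p]]] by simp
    also have "\<dots> = Zbar (Zbar (lam f)) (g p)"
      by (rule Zbar_cong[OF op gin[OF p] _ d, symmetric]) (simp add: cnjZ)
    finally show ?thesis .
  qed
  have cnjS: "cnj (S_CR f (g p))
      = (lam f (g p) * Zbar (Zbar (lam f)) (g p) - 2 * (Zbar (lam f) (g p))\<^sup>2)
        / (2 * (lam f (g p))\<^sup>2)"
    by (simp add: S_CR_def cnjZ cnjZZ gin p)

  have pos: "contact_factor f (g p) > 0" "contact_factor g p > 0"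
    using assms(12,15) gin p by (auto simp: positively_oriented_on_def)
  then have nz: "lam f (g p) \<noteq> 0" "lam g p \<noteq> 0" by simp_all
  show "S_CR (f \<circ> g) p =
      S_CR f (g p) * (Z G p)\<^sup>2 + cnj (S_CR f (g p)) * (Z Gbar p)\<^sup>2 + S_CR g p
    + (lam f (g p) * (Zbar (Z (lam f)) (g p) + Z (Zbar (lam f)) (g p))
         - 4 * Z (lam f) (g p) * Zbar (lam f) (g p))
      * (Z G p * Z Gbar p / (2 * (lam f (g p))\<^sup>2))
    + 1 / (2 * lam g p) * (lam g p * Z (Z G) p - 2 * Z G p * Z (lam g) p) * Z (ln_lam f) (g p)
    + 1 / (2 * lam g p) * (lam g p * Z (Z Gbar) p - 2 * Z Gbar p * Z (lam g) p)
      * Zbar (ln_lam f) (g p)"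
    \<comment> \<open>\<open>cnjS\<close> has to be rewritten before \<open>S_CR_def\<close>, which
      would destroy the conjugated term that it matches.\<close>
    unfolding cnjS ln_lam_derivatives[OF dlf[OF gin[OF p]] pos(1)]
    unfolding S_CR_def lam_comp[OF p] Zlam_comp[OF p] ZZlam_comp ZZL
    unfolding ZL_def L_def
    by (rule composition_identity[OF nz])
qed

end
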